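(* Let $q=2^r$. For a double coset $D=DC_i^{\epsilon}(n,q)$ with elements ordered $g_1,\dots,g_N$, and $a\in\mathbb{F}_q$, let $c_i^\epsilon(a)=(tr(a\,\mathrm{Tr}\,g_1),\dots,tr(a\,\mathrm{Tr}\,g_N))\in\mathbb{F}_2^N$. Then the map $\mathbb{F}_q\to C(D)^\perp$, $a\mapsto c_i^\epsilon(a)$, is an $\mathbb{F}_2$-linear isomorphism in each of the following cases: (a) $i\in\{1,2\}$, $\epsilon=+$, $n\ge2$ even, all $q$; (b) $i=3$, $\epsilon=+$, and either $n\ge4$ even and all $q$, or $n=2$ and $q\ge8$; (c) $i=4$, $\epsilon=+$, $n\ge4$ even, all $q$; (d) $i=1$, $\epsilon=-$, $n\ge1$ odd, all $q$; (e) $i\in\{2,3\}$, $\epsilon=-$, $n\ge3$ odd, all $q$; (f) $i=4$, $\epsilon=-$, and either $n\ge5$ odd and all $q$, or $n=3$ and $q\ge4$.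
   Context: $q=2^r$, $tr(x)=x+x^2+\cdots+x^{2^{r-1}}$ the trace $\mathbb{F}_q\to\mathbb{F}_2$. $\mathrm{Tr}$ matrix trace, ${}^tX$ transpose, alternating = symmetric with zero diagonal. Fix $\kappa\in\mathbb{F}_q$ with $z^2+z+\kappa$ irreducible. For $n\ge1$, $O^-(2n,q)$ is the group of $g\in GL(2n,q)$ preserving $\theta^-(x)=\sum_{i=1}^{n-1}x_ix_{n-1+i}+x_{2n-1}^2+x_{2n-1}x_{2n}+\kappa x_{2n}^2$. $\delta=\begin{pmatrix}1&1\\0&\kappa\end{pmatrix}$, $\eta=\begin{pmatrix}0&1\\1&0\end{pmatrix}$, $SO^-(2,q)=\{\begin{pmatrix}d_1&\kappa d_2\\ d_2&d_1+d_2\end{pmatrix}:d_1^2+d_1d_2+\kappa d_2^2=1\}$. $Q=Q^-(2n,q)$ is the group of all products (blocks $n-1,n-1,2$) $\begin{pmatrix}A&0&0\\0&{}^tA^{-1}&0\\0&0&i\end{pmatrix}\begin{pmatrix}1_{n-1}&B&{}^th\,{}^ti\,\eta\,i\\0&1_{n-1}&0\\0&h&1_2\end{pmatrix}$ with $A\in GL(n-1,q)$, $i\in SO^-(2,q)$, ${}^tB+{}^th\delta h$ alternating. $\rho=\mathrm{diag}(1_{2n-2},\begin{pmatrix}1&1\\0&1\end{pmatrix})$. $\sigma_s$ ($0\le s\le n-1$) is the permutation matrix interchanging $e^j$ and $e^{n-1+j}$ for $1\le j\le s$. $DC_1^+(n,q)=Q\sigma_{n-1}Q$, $DC_2^+(n,q)=Q\sigma_{n-2}Q$,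 $DC_3^+(n,q)=\rho Q\sigma_{n-2}Q$ ($n$ even); $DC_4^+(n,q)=\rho Q\sigma_{n-3}Q$ ($n\ge4$ even); $DC_1^-(n,q)=Q\sigma_{n-1}Q$ ($n$ odd); $DC_2^-(n,q)=Q\sigma_{n-2}Q$, $DC_3^-(n,q)=\rho Q\sigma_{n-2}Q$, $DC_4^-(n,q)=\rho Q\sigma_{n-3}Q$ ($n\ge3$ odd). Code: $C(D)=\{u\in\mathbb{F}_2^N:\sum_{k=1}^Nu_k\mathrm{Tr}(g_k)=0\text{ in }\mathbb{F}_q\}$, and $C(D)^\perp$ is its dual with respect to the standard dot product on $\mathbb{F}_2^N$. *)

theory Defs
  imports
    "Jordan_Normal_Form.Matrix"
    "HOL-Library.Cardinality"
    "HOL-Library.Z2"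
    "HOL-Computational_Algebra.Computational_Algebra"
    "HOL-Number_Theory.Residues"
begin

text \<open>The field with \<open>q = 2 ^ r\<close> elements is a type \<open>'a :: {field, finite}\<close> with
  \<open>CARD('a) = 2 ^ r\<close>; the field with two elements is the type \<^typ>\<open>bit\<close>, embedded by
  \<open>of_bit\<close>. Matrices and vectors are those of \<open>Jordan_Normal_Form\<close>, where indices start at
  \<open>0\<close> and blocks may be empty, as happens for \<open>n = 1\<close>.\<close>

definition field_trace :: "nat \<Rightarrow> 'a::field \<Rightarrow> bit" where
  "field_trace r x = (THE b. of_bit b = (\<Sum>i<r. x ^ (2 ^ i)))"

definition mat_trace :: "'a::comm_monoid_add mat \<Rightarrow> 'a" where
  "mat_trace A = (\<Sum>i<dim_row A. A $$ (i, i))"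

definition alternating_mat :: "'a::zero mat \<Rightarrow> bool" where
  "alternating_mat X \<longleftrightarrow>
     square_mat X \<and> transpose_mat X = X \<and> (\<forall>i<dim_row X. X $$ (i, i) = 0)"

definition delta_mat :: "'a::field \<Rightarrow> 'a mat" where
  "delta_mat \<kappa> = mat_of_rows_list 2 [[1, 1], [0, \<kappa>]]"

definition eta_mat :: "'a::field mat" where
  "eta_mat = mat_of_rows_list 2 [[0, 1], [1, 0]]"

definition SO2_minus :: "'a::field \<Rightarrow> 'a mat set" where
  "SO2_minus \<kappa> = {mat_of_rows_list 2 [[d1, \<kappa> * d2], [d2, d1 + d2]] | d1 d2.
     d1\<^sup>2 + d1 * d2 + \<kappa> * d2\<^sup>2 = 1}"

text \<open>In the next definition \<open>A'\<close> is the inverse of \<open>A\<close>.\<close>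

definition Q_levi :: "'a::field mat \<Rightarrow> 'a mat \<Rightarrow> 'a mat \<Rightarrow> 'a mat" where
  "Q_levi A A' i = diag_block_mat [A, transpose_mat A', i]"

text \<open>With \<open>W\<close> the product of the transpose of \<open>h\<close>, the transpose of \<open>i\<close>, \<open>\<eta>\<close> and \<open>i\<close>, this is
  the matrix with block rows \<open>(1, B, W)\<close>, \<open>(0, 1, 0)\<close>, \<open>(0, h, 1)\<close>, the blocks having sizes
  \<open>n - 1\<close>, \<open>n - 1\<close>, \<open>2\<close>.\<close>

definition Q_unip :: "nat \<Rightarrow> 'a::field mat \<Rightarrow> 'a mat \<Rightarrow> 'a mat \<Rightarrow> 'a mat" where
  "Q_unip n i B h =
     four_block_mat
       (four_block_mat (1\<^sub>m (n - 1)) B (0\<^sub>m (n - 1) (n - 1)) (1\<^sub>m (n - 1)))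
       (transpose_mat h * transpose_mat i * eta_mat * i @\<^sub>r 0\<^sub>m (n - 1) 2)
       (transpose_mat (0\<^sub>m (n - 1) 2 @\<^sub>r transpose_mat h))
       (1\<^sub>m 2)"

definition Q_minus :: "'a::field \<Rightarrow> nat \<Rightarrow> 'a mat set" where
  "Q_minus \<kappa> n = {Q_levi A A' i * Q_unip n i B h | A A' i B h.
     A \<in> carrier_mat (n - 1) (n - 1) \<and> A' \<in> carrier_mat (n - 1) (n - 1) \<and>
     inverts_mat A A' \<and> inverts_mat A' A \<and>
     i \<in> SO2_minus \<kappa> \<and>
     B \<in> carrier_mat (n - 1) (n - 1) \<and> h \<in> carrier_mat 2 (n - 1) \<and>
     alternating_mat (transpose_mat B + transpose_mat h * delta_mat \<kappa> * h)}"

definition rho_mat :: "nat \<Rightarrow> 'a::field mat" where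
  "rho_mat n = diag_block_mat [1\<^sub>m (2 * n - 2), mat_of_rows_list 2 [[1, 1], [0, 1]]]"

definition sigma_perm :: "nat \<Rightarrow> nat \<Rightarrow> nat \<Rightarrow> nat" where
  "sigma_perm n s j =
     (if j < s then n - 1 + j
      else if n - 1 \<le> j \<and> j < n - 1 + s then j - (n - 1)
      else j)"

definition sigma_mat :: "nat \<Rightarrow> nat \<Rightarrow> 'a::field mat" where
  "sigma_mat n s = mat (2 * n) (2 * n) (\<lambda>(i, j). if i = sigma_perm n s j then 1 else 0)"

definition Q_double_coset :: "'a::field \<Rightarrow> nat \<Rightarrow> nat \<Rightarrow> 'a mat set" where
  "Q_double_coset \<kappa> n s = {x * sigma_mat n s * y | x y. x \<in> Q_minus \<kappa> n \<and> y \<in> Q_minus \<kappa> n}"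

text \<open>The sign in \<open>DC\<^sub>i\<^sup>+\<close> and \<open>DC\<^sub>i\<^sup>-\<close> only records the parity of \<open>n\<close> (\<open>+\<close> for even, \<open>-\<close> for odd
  \<open>n\<close>); the defining formulas agree. The index \<open>i\<close> ranges over \<open>1, 2, 3, 4\<close>.\<close>

definition DC :: "'a::field \<Rightarrow> nat \<Rightarrow> nat \<Rightarrow> 'a mat set" where
  "DC \<kappa> i n =
     (if i = 1 then Q_double_coset \<kappa> n (n - 1)
      else if i = 2 then Q_double_coset \<kappa> n (n - 2)
      else if i = 3 then (*) (rho_mat n) ` Q_double_coset \<kappa> n (n - 2)
      else if i = 4 then (*) (rho_mat n) ` Q_double_coset \<kappa> n (n - 3)
      else {})"

text \<open>An ordering \<open>g\<^sub>1, \<dots>, g\<^sub>N\<close> of a double coset is a distinct list of its elements.\<close>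

definition trace_code :: "'a::field mat list \<Rightarrow> bit vec set" where
  "trace_code gs = {u \<in> carrier_vec (length gs).
     (\<Sum>k<length gs. of_bit (u $ k) * mat_trace (gs ! k)) = 0}"

definition dual_code :: "nat \<Rightarrow> bit vec set \<Rightarrow> bit vec set" where
  "dual_code N C = {v \<in> carrier_vec N. \<forall>u\<in>C. u \<bullet> v = 0}"

definition trace_word :: "nat \<Rightarrow> 'a::field mat list \<Rightarrow> 'a \<Rightarrow> bit vec" where
  "trace_word r gs a = vec (length gs) (\<lambda>k. field_trace r (a * mat_trace (gs ! k)))"

definition F2_linear_iso :: "('a::field \<Rightarrow> bit vec) \<Rightarrow> bit vec set \<Rightarrow> bool" where
  "F2_linear_iso f W \<longleftrightarrow>
     bij_betw f UNIV W \<and>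
     (\<forall>x y. f (x + y) = f x + f y) \<and>
     (\<forall>t x. f (of_bit t * x) = t \<cdot>\<^sub>v f x)"

text \<open>The description in \<open>field_trace\<close> does determine an element of the prime field.\<close>

lemma power_CARD_eq_self:
  fixes x :: "'a::{field,finite}"
  shows "x ^ CARD('a) = x"
proof (cases "x = 0")
  case False
  let ?U = "UNIV - {0 :: 'a}"
  have "(\<Prod>y\<in>?U. x * y) = (\<Prod>y\<in>?U. y)"
    by (rule prod.reindex_bij_witness[of _ "\<lambda>y. y / x" "\<lambda>y. x * y"]) (use False in auto)
  then have "x ^ card ?U * (\<Prod>y\<in>?U. y) = (\<Prod>y\<in>?U. y)"
    by (simp add: prod.distrib)
  then have "x ^ card ?U = 1"
    by simp
  moreover have "CARD('a) = Suc (card ?U)"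
    by (rule card.remove) simp_all
  ultimately show ?thesis
    by (simp only: power_Suc mult_1_right)
qed (simp add: power_0_left)

lemma CHAR_eq_2:
  assumes "CARD('a::{field,finite}) = 2 ^ r"
  shows "CHAR('a) = 2"
proof -
  have "prime CHAR('a)"
    by (rule prime_CHAR_semidom) (simp add: finite_imp_CHAR_pos)
  moreover have "CHAR('a) dvd 2 ^ r"
    using CHAR_dvd_CARD[where 'a = 'a] assms by simp
  ultimately show ?thesis
    using prime_dvd_power[of "CHAR('a)" 2 r] primes_dvd_imp_eq[of "CHAR('a)" 2] two_is_prime_nat
    by blast
qed

lemma of_bit_field_trace:
  fixes x :: "'a::{field,finite}"
  assumes "CARD('a) = 2 ^ r"
  shows "of_bit (field_trace r x) = (\<Sum>i<r. x ^ (2 ^ i))"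
proof -
  define S T where "S = (\<Sum>i<r. x ^ (2 ^ i))" and "T = (\<Sum>i<r. x ^ (2 ^ Suc i))"
  have c: "CHAR('a) = 2"
    using assms by (rule CHAR_eq_2)
  have "S ^ CHAR('a) = (\<Sum>i<r. (x ^ (2 ^ i)) ^ CHAR('a))"
    unfolding S_def by (rule freshmans_dream_sum) (simp_all add: c)
  also have "\<dots> = T"
    unfolding T_def c by (rule sum.cong) (simp_all only: power_Suc2 power_mult)
  finally have "S * S = T"
    by (simp only: c power2_eq_square)
  moreover have "x + T = S + x ^ (2 ^ r)"
    using sum.lessThan_Suc_shift[of "\<lambda>i. x ^ (2 ^ i)" r]
      sum.lessThan_Suc[of "\<lambda>i. x ^ (2 ^ i)" r]
    unfolding S_def T_def by (simp only: power_0 power_one_right)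
  moreover have "x ^ (2 ^ r) = x"
    using power_CARD_eq_self[of x] unfolding assms .
  ultimately have "S * S = S"
    by simp
  then have "S = 0 \<or> S = 1"
    by simp
  then obtain b :: bit where b: "of_bit b = S"
    using that[of 0] that[of 1] by fastforce
  show ?thesis
    unfolding field_trace_def S_def[symmetric]
  proof (rule theI)
    show "of_bit b = S" by (rule b)
    show "b' = b" if "of_bit b' = S" for b'
      using that b by (cases b; cases b') (auto simp: of_bool_def split: if_splits)
  qed
qed

end

theory Submission
  imports Defs
begin

text \<open>By Delsarte's theorem (the dual of the kernel of \<open>u \<mapsto> \<Sum>u\<^sub>k Tr g\<^sub>k\<close> consists of the words
  \<open>tr (a * Tr g\<^sub>k)\<close>), everything reduces to showing that the matrix traces of a double coset
  generate the additive group of the field.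

  Multiplying \<open>\<sigma>\<^sub>s\<close> with \<open>s \<ge> 1\<close> by the unipotent element of \<open>Q\<close> for which \<open>h\<close> has the single
  entry \<open>t\<close> and \<open>B\<close> the single entry \<open>t\<^sup>2\<close> gives trace \<open>t\<^sup>2\<close>, with or without the factor \<open>\<rho>\<close>; squaring
  is onto, so every element is a trace. The cases with \<open>s = 0\<close> remain, where Levi elements have
  trace \<open>Tr A + Tr A\<^sup>-\<^sup>1 + Tr i\<close>, and \<open>\<rho>\<close> replaces the last summand by \<open>0\<close>. Without \<open>\<rho>\<close> one takes
  \<open>A = 1\<close>: the traces of \<open>SO\<^sup>-(2, q)\<close> alone fill more than half of the field. With \<open>\<rho>\<close> and \<open>n = 3\<close>,
  companion matrices \<open>A\<close> of fixed determinant \<open>d \<noteq> 1\<close> realise every element. With \<open>\<rho>\<close> and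
  \<open>n = 2\<close>, the elements \<open>a + 1/a\<close> generate a subfield of index at most two, which is
  the whole field once \<open>q \<ge> 8\<close>.\<close>

unbundle no Formal_Power_Series.fps_syntax

section \<open>Fields of characteristic two\<close>

lemma add_self_CHAR_2:
  fixes x :: "'a::field"
  assumes "CHAR('a) = 2"
  shows "x + x = 0"
proof -
  have "of_nat 2 = (0::'a)"
    using of_nat_CHAR[where 'a='a] assms by simp
  then have "x * 2 = 0" by simp
  then show ?thesis by (simp only: mult_2_right)
qed

lemma add_eq_0_iff_CHAR_2:
  fixes x y :: "'a::field"
  assumes "CHAR('a) = 2"
  shows "x + y = 0 \<longleftrightarrow> x = y"
  using add_self_CHAR_2[OF assms, of y] by (metis add_right_cancel)

lemma power2_add_CHAR_2:
  fixes x y :: "'a::field"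
  assumes "CHAR('a) = 2"
  shows "(x + y)\<^sup>2 = x\<^sup>2 + y\<^sup>2"
proof -
  have "(x + y)\<^sup>2 = x\<^sup>2 + y\<^sup>2 + (x * y + x * y)"
    by (simp add: power2_eq_square algebra_simps)
  then show ?thesis by (simp add: add_self_CHAR_2[OF assms])
qed

lemma inj_power2_CHAR_2:
  assumes "CHAR('a::field) = 2"
  shows "inj (\<lambda>x::'a. x\<^sup>2)"
proof (rule injI)
  fix x y :: 'a
  assume "x\<^sup>2 = y\<^sup>2"
  then have "(x + y)\<^sup>2 = 0"
    by (simp add: power2_add_CHAR_2[OF assms] add_self_CHAR_2[OF assms])
  then show "x = y" using add_eq_0_iff_CHAR_2[OF assms] by auto
qed

lemma surj_power2_CHAR_2:
  assumes "CHAR('a::{field,finite}) = 2"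
  shows "surj (\<lambda>x::'a. x\<^sup>2)"
  using inj_power2_CHAR_2[OF assms] by (simp add: finite_UNIV_inj_surj)

lemma of_bit_add:
  assumes "CHAR('a::field) = 2"
  shows "of_bit (b + c) = (of_bit b + of_bit c :: 'a)"
  using add_self_CHAR_2[OF assms, of 1] by (cases b; cases c) auto

lemma of_bit_inject: "of_bit b = (of_bit c :: 'a::field) \<longleftrightarrow> b = c"
  by (cases b; cases c) auto

section \<open>Trace form and additive functionals\<close>

text \<open>The values are integers, not field elements: a nonvanishing character sum such as
  \<open>q\<close> would be zero in characteristic two.\<close>

definition sign_of_bit :: "bit \<Rightarrow> int" where
  "sign_of_bit b = (if b = 0 then 1 else - 1)"

lemma sign_of_bit_add: "sign_of_bit (b + c) = sign_of_bit b * sign_of_bit c"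
  by (cases b; cases c) (auto simp: sign_of_bit_def)

context
  fixes r :: nat
  assumes card: "CARD('a::{field,finite}) = 2 ^ r"
begin

lemma field_trace_add: "field_trace r (x + y :: 'a) = field_trace r x + field_trace r y"
proof -
  have c: "CHAR('a) = 2" using card by (rule CHAR_eq_2)
  have p: "(x + y) ^ (2 ^ i) = x ^ (2 ^ i) + y ^ (2 ^ i)" for i
  proof (induction i)
    case (Suc i)
    then show ?case
      by (simp only: power_Suc2 power_mult power2_add_CHAR_2[OF c])
  qed simp
  have "(of_bit (field_trace r (x + y)) :: 'a) = of_bit (field_trace r x + field_trace r y)"
    by (simp only: of_bit_field_trace[OF card] p sum.distrib of_bit_add[OF c])
  then show ?thesis by (simp only: of_bit_inject)
qed

lemma field_trace_0: "field_trace r (0 :: 'a) = 0"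
  using field_trace_add[of 0 0] by (cases "field_trace r (0 :: 'a)") auto

lemma field_trace_of_bit_mult: "field_trace r (of_bit b * x :: 'a) = b * field_trace r x"
  by (cases b) (auto simp: field_trace_0)

lemma field_trace_sum:
  "field_trace r (\<Sum>k\<in>K. f k :: 'a) = (\<Sum>k\<in>K. field_trace r (f k))"
  by (induction K rule: infinite_finite_induct) (auto simp: field_trace_0 field_trace_add)

text \<open>The trace is given by a nonzero polynomial of degree at most \<open>2 ^ (r - 1)\<close>,
  which has too few roots to vanish on all \<open>2 ^ r\<close> elements.\<close>

lemma field_trace_nontrivial: "\<exists>x::'a. field_trace r x = 1"
proof (rule ccontr)
  assume "\<nexists>x::'a. field_trace r x = 1"
  then have z: "field_trace r x = 0" for x :: 'a by simp
  define p :: "'a poly" where "p = (\<Sum>i<r. Polynomial.monom 1 (2 ^ i))"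
  have "2 \<le> CARD('a)"
    using card_mono[of UNIV "{0, 1 :: 'a}"] by simp
  then have r: "r > 0" using card by (cases r) auto
  \<comment> \<open>Among the exponents \<open>2 ^ i\<close> only \<open>i = 0\<close> gives 1, so
    this coefficient shows that \<open>p\<close> is nonzero.\<close>
  have "Polynomial.coeff p 1 = (\<Sum>i<r. if i = 0 then 1 else 0)"
    unfolding p_def coeff_sum by (rule sum.cong) auto
  then have p0: "p \<noteq> 0" using r by auto
  have "degree p \<le> 2 ^ (r - 1)"
    unfolding p_def
    by (rule degree_sum_le) (auto intro: order.trans[OF degree_monom_le])
  moreover have "poly p x = 0" for x
  proof -
    have "poly p x = (\<Sum>i<r. x ^ (2 ^ i))"
      by (simp add: p_def poly_sum poly_monom)
    then show ?thesis using of_bit_field_trace[OF card, of x] z[of x] by simp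
  qed
  ultimately have "CARD('a) \<le> 2 ^ (r - 1)"
    using card_poly_roots_bound[OF p0] by simp
  then show False using r card by (cases r) auto
qed

lemma field_trace_nondegenerate:
  fixes a :: 'a
  assumes "\<And>x. field_trace r (a * x) = 0"
  shows "a = 0"
proof (rule ccontr)
  assume a: "a \<noteq> 0"
  obtain y :: 'a where "field_trace r y = 1" using field_trace_nontrivial by blast
  then show False using assms[of "y / a"] a by simp
qed

text \<open>Translation by \<open>z\<close> permutes the field and flips every sign, so the sum
  equals its own negative.\<close>

lemma sum_sign_of_bit_eq_0:
  fixes \<phi> :: "'a \<Rightarrow> bit"
  assumes "\<And>x y. \<phi> (x + y) = \<phi> x + \<phi> y" and "\<phi> z = 1"
  shows "(\<Sum>x\<in>UNIV. sign_of_bit (\<phi> x)) = 0"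
proof -
  have "(\<Sum>x\<in>UNIV. sign_of_bit (\<phi> x)) = (\<Sum>x\<in>UNIV. sign_of_bit (\<phi> (x + z)))"
    by (rule sum.reindex_bij_witness[of _ "\<lambda>x. x + z" "\<lambda>x. x - z"]) auto
  also have "\<dots> = - (\<Sum>x\<in>UNIV. sign_of_bit (\<phi> x))"
    by (simp only: assms sign_of_bit_add) (simp add: sign_of_bit_def sum_negf)
  finally show ?thesis by simp
qed

text \<open>The sum of \<open>(-1) ^ (\<phi> x + tr (a * x))\<close> over all \<open>a\<close> and \<open>x\<close> equals \<open>q\<close>, because only
  \<open>x = 0\<close> contributes; so for some \<open>a\<close> the additive map \<open>x \<mapsto> \<phi> x + tr (a * x)\<close> has a nonzero
  character sum, that is, it vanishes.\<close>

lemma additive_functional_eq_field_trace: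
  fixes \<phi> :: "'a \<Rightarrow> bit"
  assumes add: "\<And>x y. \<phi> (x + y) = \<phi> x + \<phi> y"
  shows "\<exists>a. \<forall>x. \<phi> x = field_trace r (a * x)"
proof -
  have \<phi>0: "\<phi> 0 = 0" using add[of 0 0] by (cases "\<phi> 0") auto
  have inner: "(\<Sum>a\<in>UNIV. sign_of_bit (field_trace r (a * x))) =
      (if x = 0 then int CARD('a) else 0)" for x :: 'a
  proof (cases "x = 0")
    case True
    then show ?thesis by (simp add: field_trace_0 sign_of_bit_def)
  next
    case False
    obtain y :: 'a where "field_trace r y = 1" using field_trace_nontrivial by blast
    then show ?thesis
      using False sum_sign_of_bit_eq_0[of "\<lambda>a. field_trace r (a * x)" "y / x"]
      by (simp add: field_trace_add distrib_right)
  qed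
  have "(\<Sum>a\<in>UNIV. \<Sum>x\<in>UNIV. sign_of_bit (\<phi> x + field_trace r (a * x))) =
      (\<Sum>x\<in>UNIV. sign_of_bit (\<phi> x) * (\<Sum>a\<in>UNIV. sign_of_bit (field_trace r (a * x))))"
    by (subst sum.swap) (simp only: sign_of_bit_add sum_distrib_left)
  also have "\<dots> = int CARD('a)"
    unfolding inner by (simp add: \<phi>0 sign_of_bit_def if_distrib[of "\<lambda>c. _ * c"] cong: if_cong)
  finally obtain a where
    a: "(\<Sum>x\<in>UNIV. sign_of_bit (\<phi> x + field_trace r (a * x))) \<noteq> 0"
    by (metis (no_types, lifting) sum.neutral of_nat_0_eq_iff finite_UNIV_card_ge_0 finite
        less_irrefl)
  have nz: "\<phi> x + field_trace r (a * x) \<noteq> 1" for x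
  proof
    assume "\<phi> x + field_trace r (a * x) = 1"
    moreover have "\<phi> (x + y) + field_trace r (a * (x + y)) =
        (\<phi> x + field_trace r (a * x)) + (\<phi> y + field_trace r (a * y))" for x y
      by (simp only: add field_trace_add distrib_left ac_simps)
    ultimately show False
      using a sum_sign_of_bit_eq_0[of "\<lambda>x. \<phi> x + field_trace r (a * x)" x] by blast
  qed
  have "\<phi> x = field_trace r (a * x)" for x
    using nz[of x] by (cases "\<phi> x"; cases "field_trace r (a * x)") auto
  then show ?thesis by blast
qed

section \<open>Delsarte duality for trace codes\<close>

text \<open>The assumption \<open>gen\<close> says that the matrix traces generate the additive
  group, which makes the syndrome map \<open>L\<close> onto. Injectivity then follows from
  nondegeneracy of the trace form. Conversely, a dual word induces an additive functional on the
  field through \<open>L\<close>, and every such functional is a trace form.\<close>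

lemma trace_word_iso:
  fixes gs :: "'a mat list"
  assumes gen: "\<And>H. 0 \<in> H \<Longrightarrow> (\<And>x y. x \<in> H \<Longrightarrow> y \<in> H \<Longrightarrow> x + y \<in> H) \<Longrightarrow>
    mat_trace ` set gs \<subseteq> H \<Longrightarrow> H = UNIV"
  shows "F2_linear_iso (trace_word r gs) (dual_code (length gs) (trace_code gs))"
proof -
  define N where "N = length gs"
  define L where "L u = (\<Sum>k<N. of_bit (u $ k) * mat_trace (gs ! k))" for u :: "bit vec"
  have c: "CHAR('a) = 2" using card by (rule CHAR_eq_2)
  have L_add: "L (u + v) = L u + L v" if "u \<in> carrier_vec N" "v \<in> carrier_vec N" for u v
  proof -
    have "L (u + v) = (\<Sum>k<N. (of_bit (u $ k) + of_bit (v $ k)) * mat_trace (gs ! k))"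
      unfolding L_def using that
      by (intro sum.cong refl) (simp only: of_bit_add[OF c, symmetric], auto)
    then show ?thesis by (simp add: L_def distrib_right sum.distrib)
  qed
  have L_0: "L (0\<^sub>v N) = 0" by (simp add: L_def)
  have L_unit: "L (unit_vec N k) = mat_trace (gs ! k)" if "k < N" for k
  proof -
    have "L (unit_vec N k) = (\<Sum>j<N. if j = k then mat_trace (gs ! j) else 0)"
      unfolding L_def by (rule sum.cong) (auto simp: unit_vec_def)
    then show ?thesis using that by simp
  qed
  \<comment> \<open>The image is additively closed and contains the generators as the values at unit
    vectors.\<close>
  have "L ` carrier_vec N = UNIV"
  proof (rule gen)
    show "0 \<in> L ` carrier_vec N" using L_0 by (metis image_eqI zero_carrier_vec)
    show "x + y \<in> L ` carrier_vec N" if "x \<in> L ` carrier_vec N" "y \<in> L ` carrier_vec N" for x y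
      using that by (auto simp flip: L_add)
    show "mat_trace ` set gs \<subseteq> L ` carrier_vec N"
    proof
      fix t assume "t \<in> mat_trace ` set gs"
      then obtain k where "k < N" "t = mat_trace (gs ! k)"
        unfolding N_def by (auto simp: in_set_conv_nth)
      then show "t \<in> L ` carrier_vec N" using L_unit by (metis image_eqI unit_vec_carrier)
    qed
  qed
  then have L_surj: "\<exists>u\<in>carrier_vec N. L u = y" for y by (metis UNIV_I imageE)
  have word: "trace_word r gs a \<in> carrier_vec N" for a :: 'a
    by (simp add: trace_word_def N_def)
  \<comment> \<open>The word map is the adjoint of \<open>L\<close> with respect to the dot product
    and the trace form.\<close>
  have pair: "u \<bullet> trace_word r gs a = field_trace r (a * L u)" for u a
  proof -
    have "u \<bullet> trace_word r gs a = (\<Sum>k<N. u $ k * field_trace r (a * mat_trace (gs ! k)))"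
      unfolding scalar_prod_def using word[of a]
      by (intro sum.cong) (auto simp: trace_word_def N_def)
    also have "\<dots> = (\<Sum>k<N. field_trace r (a * (of_bit (u $ k) * mat_trace (gs ! k))))"
      by (simp only: field_trace_of_bit_mult[symmetric] mult.left_commute)
    finally show ?thesis by (simp only: L_def field_trace_sum sum_distrib_left)
  qed
  have code: "trace_code gs = {u \<in> carrier_vec N. L u = 0}"
    by (simp add: trace_code_def L_def N_def)
  have "inj (trace_word r gs)"
  proof (rule injI)
    fix a b :: 'a
    assume eq: "trace_word r gs a = trace_word r gs b"
    have "field_trace r ((a + b) * y) = 0" for y
    proof -
      obtain u where "L u = y" using L_surj by blast
      then have "field_trace r (a * y) = field_trace r (b * y)"
        using pair[of u a] pair[of u b] eq by simp
      then show ?thesis by (simp add: distrib_right field_trace_add)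
    qed
    then have "a + b = 0" by (rule field_trace_nondegenerate)
    then show "a = b" using add_eq_0_iff_CHAR_2[OF c] by blast
  qed
  moreover have "range (trace_word r gs) = dual_code N (trace_code gs)"
  proof
    show "range (trace_word r gs) \<subseteq> dual_code N (trace_code gs)"
      using word by (auto simp: dual_code_def code pair field_trace_0)
    show "dual_code N (trace_code gs) \<subseteq> range (trace_word r gs)"
    proof
      fix v assume "v \<in> dual_code N (trace_code gs)"
      then have v: "v \<in> carrier_vec N"
        and ker: "\<And>u. u \<in> carrier_vec N \<Longrightarrow> L u = 0 \<Longrightarrow> u \<bullet> v = 0"
        by (auto simp: dual_code_def code)
      \<comment> \<open>In characteristic two \<open>u + w\<close> is a codeword, so pairing with
        \<open>v\<close> factors through \<open>L\<close>.\<close>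
      have well: "u \<bullet> v = w \<bullet> v" if "u \<in> carrier_vec N" "w \<in> carrier_vec N" "L u = L w" for u w
      proof -
        have "(u + w) \<bullet> v = 0"
          using that by (intro ker) (auto simp: L_add add_self_CHAR_2[OF c])
        then have "u \<bullet> v + w \<bullet> v = 0"
          using that v by (simp add: add_scalar_prod_distrib[where n = N])
        then show ?thesis by (cases "u \<bullet> v"; cases "w \<bullet> v") auto
      qed
      \<comment> \<open>An arbitrary section of \<open>L\<close>, not claimed to be additive; by
        \<open>well\<close> its pairing with \<open>v\<close> is additive all the same.\<close>
      obtain S where S: "\<And>y. S y \<in> carrier_vec N" "\<And>y. L (S y) = y"
        using L_surj by metis
      have "S (x + y) \<bullet> v = S x \<bullet> v + S y \<bullet> v" for x y
      proof -
        have "S (x + y) \<bullet> v = (S x + S y) \<bullet> v"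
          using S by (intro well) (auto simp: L_add)
        then show ?thesis using S v by (simp add: add_scalar_prod_distrib[where n = N])
      qed
      from additive_functional_eq_field_trace[of "\<lambda>y. S y \<bullet> v", OF this]
      obtain a where a: "\<And>y. S y \<bullet> v = field_trace r (a * y)" by blast
      have "v = trace_word r gs a"
      proof (rule eq_vecI)
        fix k assume "k < dim_vec (trace_word r gs a)"
        then have k: "k < N" using word[of a] by simp
        have "v $ k = unit_vec N k \<bullet> v" using v k by simp
        also have "\<dots> = S (L (unit_vec N k)) \<bullet> v" using S by (intro well) auto
        also have "\<dots> = unit_vec N k \<bullet> trace_word r gs a" by (simp only: a pair)
        also have "\<dots> = trace_word r gs a $ k" using word k by simp
        finally show "v $ k = trace_word r gs a $ k" .
      qed (use carrier_vecD[OF v] carrier_vecD[OF word] in simp)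
      then show "v \<in> range (trace_word r gs)" by blast
    qed
  qed
  moreover have "trace_word r gs (x + y) = trace_word r gs x + trace_word r gs y" for x y :: 'a
    by (auto simp: trace_word_def distrib_right field_trace_add)
  moreover have "trace_word r gs (of_bit t * x) = t \<cdot>\<^sub>v trace_word r gs x" for t and x :: 'a
    by (cases t) (auto simp: trace_word_def field_trace_0 intro!: eq_vecI)
  ultimately show ?thesis
    unfolding F2_linear_iso_def bij_betw_def N_def by blast
qed

end

section \<open>Generation by large subsets and by the values of \<open>a + 1 / a\<close>\<close>

text \<open>By pigeonhole \<open>T\<close> meets \<open>y - T\<close>, so every \<open>y\<close> is
  a sum of two elements of \<open>T\<close>.\<close>

lemma add_closed_eq_UNIV_if_gt_half:
  fixes H :: "'a::{ab_group_add,finite} set"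
  assumes add: "\<And>x y. x \<in> H \<Longrightarrow> y \<in> H \<Longrightarrow> x + y \<in> H"
    and T: "T \<subseteq> H" "CARD('a) < 2 * card T"
  shows "H = UNIV"
proof -
  have "y \<in> H" for y
  proof -
    have "card ((\<lambda>t. y - t) ` T) = card T"
      by (rule card_image) (auto simp: inj_on_def)
    moreover have "card (T \<union> (\<lambda>t. y - t) ` T) \<le> CARD('a)" by (rule card_mono) auto
    ultimately have "T \<inter> (\<lambda>t. y - t) ` T \<noteq> {}"
      using card_Un_Int[of T "(\<lambda>t. y - t) ` T"] T(2) by auto
    then obtain t u where "t \<in> T" "u \<in> T" "t = y - u" by blast
    then show ?thesis using add[of t u] T(1) by (auto simp: subset_iff)
  qed
  then show ?thesis by blast
qed

text \<open>The fibres over the image cover \<open>A\<close> and have at most two elements each. It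
  serves for the two-to-one maps \<open>z\<^sup>2 + z + \<kappa>\<close> and
  \<open>a + 1/a\<close>.\<close>

lemma card_le_2_card_image:
  assumes "finite A" and "\<And>y. y \<in> A \<Longrightarrow> \<exists>b c. {x \<in> A. f x = f y} \<subseteq> {b, c}"
  shows "card A \<le> 2 * card (f ` A)"
proof -
  have "card {x \<in> A. f x = z} \<le> 2" if z: "z \<in> f ` A" for z
  proof -
    obtain y where "y \<in> A" "z = f y" using z by blast
    then obtain b c where "{x \<in> A. f x = z} \<subseteq> {b, c}" using assms(2) by blast
    then have "card {x \<in> A. f x = z} \<le> card {b, c}" by (intro card_mono) auto
    also have "\<dots> \<le> 2" by (simp add: card_insert_if)
    finally show ?thesis .
  qed
  moreover have "A = (\<Union>z\<in>f ` A. {x \<in> A. f x = z})" by auto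
  moreover have "card (\<Union>z\<in>f ` A. {x \<in> A. f x = z}) \<le> (\<Sum>z\<in>f ` A. card {x \<in> A. f x = z})"
    using assms(1) by (intro card_UN_le) auto
  ultimately have "card A \<le> (\<Sum>z\<in>f ` A. card {x \<in> A. f x = z})" by simp
  also have "\<dots> \<le> (\<Sum>z\<in>f ` A. 2)"
    by (rule sum_mono) (use \<open>\<And>z. z \<in> f ` A \<Longrightarrow> card {x \<in> A. f x = z} \<le> 2\<close> in blast)
  finally show ?thesis by simp
qed

text \<open>For \<open>d2\<close> nonzero and \<open>z = d1 / d2\<close> the equation reads
  \<open>d2\<^sup>2 * f z = 1\<close>, so \<open>d2\<close> is the inverse square root of
  \<open>f z\<close>. Since \<open>f\<close> is at most two-to-one, this gives at least
  \<open>q / 2\<close> nonzero values, and \<open>d2 = 0\<close> makes the bound strict.\<close>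

lemma norm_form_second_coordinates:
  fixes \<kappa> :: "'a::{field,finite}"
  assumes c: "CHAR('a) = 2" and irr: "\<And>z. z\<^sup>2 + z + \<kappa> \<noteq> 0"
  shows "CARD('a) < 2 * card {d2. \<exists>d1. d1\<^sup>2 + d1 * d2 + \<kappa> * d2\<^sup>2 = 1}"
proof -
  let ?T = "{d2. \<exists>d1. d1\<^sup>2 + d1 * d2 + \<kappa> * d2\<^sup>2 = 1}"
  define f where "f z = z\<^sup>2 + z + \<kappa>" for z
  obtain s where s: "\<And>x::'a. (s x)\<^sup>2 = x"
    using surj_power2_CHAR_2[OF c] by (metis surjD)
  have two: "\<exists>b c. {x \<in> UNIV. f x = f y} \<subseteq> {b, c}" for y
  proof -
    \<comment> \<open>The constant cancels and \<open>f x + f y\<close> factors as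
      \<open>(x + y) * (x + y + 1)\<close>.\<close>
    have "x = y \<or> x = y + 1" if "f x = f y" for x
    proof -
      have "(x + y)\<^sup>2 + (x + y) + (\<kappa> + \<kappa>) = f x + f y"
        by (simp only: f_def power2_add_CHAR_2[OF c] ac_simps)
      then have "(x + y)\<^sup>2 + (x + y) = 0"
        using that by (simp only: add_self_CHAR_2[OF c] add_0_right)
      then have "(x + y) * (x + y + 1) = 0" by (simp add: power2_eq_square algebra_simps)
      then have "x + y = 0 \<or> x + (y + 1) = 0" by (auto simp: add.assoc)
      then show ?thesis using add_eq_0_iff_CHAR_2[OF c] by blast
    qed
    then show ?thesis by blast
  qed
  have "CARD('a) \<le> 2 * card (range f)"
    by (rule card_le_2_card_image) (use two in auto)
  moreover have "card ((\<lambda>w. inverse (s w)) ` range f) = card (range f)"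
    by (intro card_image inj_onI) (simp, metis s)
  moreover have "insert 0 ((\<lambda>w. inverse (s w)) ` range f) \<subseteq> ?T"
  proof -
    have "inverse (s (f z)) \<in> ?T" for z
    proof -
      let ?d = "inverse (s (f z))"
      have "s (f z) \<noteq> 0" using irr[of z] s[of "f z"] by (auto simp: f_def)
      moreover have "(z * ?d)\<^sup>2 + (z * ?d) * ?d + \<kappa> * ?d\<^sup>2 = f z * ?d\<^sup>2"
        by (simp add: f_def power2_eq_square algebra_simps)
      moreover have "f z * ?d\<^sup>2 = (s (f z) * ?d)\<^sup>2"
        by (simp only: s power_mult_distrib)
      ultimately have "(z * ?d)\<^sup>2 + (z * ?d) * ?d + \<kappa> * ?d\<^sup>2 = 1" by simp
      then show ?thesis by blast
    qed
    moreover have "0 \<in> ?T" by (auto intro!: exI[of _ 1])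
    ultimately show ?thesis by blast
  qed
  then have "card (insert 0 ((\<lambda>w. inverse (s w)) ` range f)) \<le> card ?T"
    by (intro card_mono) auto
  moreover have "0 \<notin> (\<lambda>w. inverse (s w)) ` range f"
  proof
    assume "0 \<in> (\<lambda>w. inverse (s w)) ` range f"
    then obtain z where "s (f z) = 0" by auto
    then show False using irr[of z] s[of "f z"] by (simp add: f_def)
  qed
  ultimately show ?thesis by simp
qed

text \<open>Since \<open>(a + 1/a) (b + 1/b) = (ab + 1/(ab)) + (a/b + b/a)\<close>, the elements generate a subring,
  hence a subfield, of index at most two. A proper subfield of \<open>F\<^sub>q\<close> has at most \<open>\<surd>q\<close>
  elements, which is less than \<open>q / 2\<close> for \<open>q \<ge> 8\<close>.\<close>

lemma add_closed_eq_UNIV_if_add_inverse: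
  fixes H :: "'a::{field,finite} set"
  assumes c: "CHAR('a) = 2" and q: "CARD('a) \<ge> 8"
    and H0: "0 \<in> H" and add: "\<And>x y. x \<in> H \<Longrightarrow> y \<in> H \<Longrightarrow> x + y \<in> H"
    and sub: "\<And>a. a \<noteq> 0 \<Longrightarrow> a + inverse a \<in> H"
  shows "H = UNIV"
proof (rule ccontr)
  assume "H \<noteq> UNIV"
  \<comment> \<open>\<open>H\<close> is not known to be closed under products, so the argument
    passes to the additive group generated by the values \<open>a + 1/a\<close>. Its minimality,
    \<open>Kleast\<close>, acts as an induction principle in each factor of a product.\<close>
  define K :: "'a set" where "K = \<Inter>{S. 0 \<in> S \<and> (\<forall>x\<in>S. \<forall>y\<in>S. x + y \<in> S) \<and>
    (\<forall>a. a \<noteq> 0 \<longrightarrow> a + inverse a \<in> S)}"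
  have K0: "0 \<in> K" and Kadd: "\<And>x y. x \<in> K \<Longrightarrow> y \<in> K \<Longrightarrow> x + y \<in> K"
    and Kgen: "\<And>a. a \<noteq> 0 \<Longrightarrow> a + inverse a \<in> K"
    unfolding K_def by blast+
  have Kleast: "K \<subseteq> S" if "0 \<in> S" "\<And>x y. x \<in> S \<Longrightarrow> y \<in> S \<Longrightarrow> x + y \<in> S"
    "\<And>a. a \<noteq> 0 \<Longrightarrow> a + inverse a \<in> S" for S
    unfolding K_def using that by blast
  have "K \<subseteq> H" using assms by (intro Kleast) auto
  then obtain x where x: "x \<notin> K" using \<open>H \<noteq> UNIV\<close> by blast
  have gen_mult: "(a + inverse a) * y \<in> K" if a: "a \<noteq> 0" and y: "y \<in> K" for a y
  proof -
    have "K \<subseteq> {y. (a + inverse a) * y \<in> K}"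
    proof (rule Kleast; clarsimp simp: K0 distrib_left intro!: Kadd)
      fix b :: 'a assume b: "b \<noteq> 0"
      have "(a + inverse a) * b + (a + inverse a) * inverse b =
          (a * b + inverse (a * b)) + (a / b + inverse (a / b))"
        using a b by (simp add: field_simps)
      also have "\<dots> \<in> K" using a b by (intro Kadd Kgen) auto
      finally show "(a + inverse a) * b + (a + inverse a) * inverse b \<in> K" .
    qed
    then show ?thesis using y by blast
  qed
  have Kmult: "z * y \<in> K" if z: "z \<in> K" and y: "y \<in> K" for z y
  proof -
    have "K \<subseteq> {z. z * y \<in> K}"
    proof (rule Kleast)
      show "u + v \<in> {z. z * y \<in> K}" if "u \<in> {z. z * y \<in> K}" "v \<in> {z. z * y \<in> K}" for u v
        using that Kadd by (simp add: distrib_right)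
    qed (use K0 gen_mult y in auto)
    then show ?thesis using z by blast
  qed
  \<comment> \<open>Multiplication by \<open>y\<close> is an injective self-map of the finite set
    \<open>K\<close>, hence onto.\<close>
  have Kdiv: "z / y \<in> K" if z: "z \<in> K" and y: "y \<in> K" "y \<noteq> 0" for z y
  proof -
    have "inj_on (\<lambda>w. w * y) K" using y by (auto simp: inj_on_def)
    moreover have "(\<lambda>w. w * y) ` K \<subseteq> K" using Kmult y by auto
    ultimately have "(\<lambda>w. w * y) ` K = K" by (intro endo_inj_surj) auto
    then obtain w where "w \<in> K" "z = w * y" using z by blast
    then show ?thesis using y by simp
  qed
  \<comment> \<open>For \<open>x\<close> outside the subfield \<open>K\<close>, the elements 1 and
    \<open>x\<close> are independent over \<open>K\<close>, which forces \<open>q\<close> to be at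
    least the square of \<open>card K\<close>.\<close>
  have "inj_on (\<lambda>(a, b). a + b * x) (K \<times> K)"
  proof (rule inj_onI; clarsimp)
    fix a b a' b'
    assume K: "a \<in> K" "b \<in> K" "a' \<in> K" "b' \<in> K" and eq: "a + b * x = a' + b' * x"
    have "b = b'"
    proof (rule ccontr)
      assume "b \<noteq> b'"
      then have "b + b' \<noteq> 0" using add_eq_0_iff_CHAR_2[OF c] by blast
      moreover have "(b + b') * x = a + a'"
      proof -
        have "(b + b') * x + (a + a') = (a + b * x) + (a' + b' * x)" by (simp add: algebra_simps)
        also have "\<dots> = 0" by (simp only: eq add_self_CHAR_2[OF c])
        finally show ?thesis using add_eq_0_iff_CHAR_2[OF c] by blast
      qed
      ultimately have "x = (a + a') / (b + b')" by (simp add: field_simps)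
      then show False using x K Kadd Kdiv \<open>b + b' \<noteq> 0\<close> by blast
    qed
    then show "a = a' \<and> b = b'" using eq by simp
  qed
  then have "card (K \<times> K) \<le> CARD('a)"
    by (metis card_image card_mono finite_UNIV finite subset_UNIV)
  then have sq: "card K * card K \<le> CARD('a)" by (simp add: card_cartesian_product)
  \<comment> \<open>Equal values mean that \<open>a\<close> is a root of
    \<open>(X + y) * (X + 1/y)\<close>, so \<open>a\<close> is \<open>y\<close> or its
    inverse.\<close>
  have "\<exists>b c. {a \<in> UNIV - {0::'a}. a + inverse a = y + inverse y} \<subseteq> {b, c}"
    if y: "y \<in> UNIV - {0}" for y
  proof -
    have "a = y \<or> a = inverse y" if a: "a \<noteq> 0" "a + inverse a = y + inverse y" for a
    proof -
      have "(a + y) * (a + inverse y) = a * (a + inverse a + (y + inverse y))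
        + (y * inverse y - a * inverse a)"
        by (simp add: algebra_simps)
      also have "\<dots> = 0" using a y by (simp add: add_self_CHAR_2[OF c])
      finally show ?thesis by (auto simp: add_eq_0_iff_CHAR_2[OF c])
    qed
    then show ?thesis by blast
  qed
  then have "card (UNIV - {0::'a}) \<le> 2 * card ((\<lambda>a. a + inverse a) ` (UNIV - {0::'a}))"
    by (intro card_le_2_card_image) auto
  also have "\<dots> \<le> 2 * card K"
    by (intro mult_le_mono card_mono) (auto intro: Kgen)
  finally have "CARD('a) \<le> 2 * card K + 1" by (simp add: card_Diff_singleton)
  \<comment> \<open>With \<open>k = card K\<close>, the bounds
    \<open>4 * k \<le> k * k \<le> q \<le> 2 * k + 1\<close> contradict each other.\<close>
  then have "4 \<le> card K" using q by simp
  then have "4 * card K \<le> card K * card K" by simp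
  then show False using sq \<open>CARD('a) \<le> 2 * card K + 1\<close> \<open>4 \<le> card K\<close> by linarith
qed

section \<open>Traces of elements of the double cosets\<close>

lemma sum_lessThan_add:
  fixes f :: "nat \<Rightarrow> 'a::comm_monoid_add"
  shows "(\<Sum>i<a + b. f i) = (\<Sum>i<a. f i) + (\<Sum>i<b. f (a + i))"
  by (induction b) (auto simp: ac_simps)

lemma mat_trace_four_block:
  assumes "A \<in> carrier_mat a a" "D \<in> carrier_mat d d"
  shows "mat_trace (four_block_mat A B C D) = mat_trace A + mat_trace D"
  using assms by (simp add: mat_trace_def sum_lessThan_add)

lemma mat_trace_transpose: "A \<in> carrier_mat a a \<Longrightarrow> mat_trace (transpose_mat A) = mat_trace A"
  by (simp add: mat_trace_def)

lemma mat_trace_one: "mat_trace (1\<^sub>m a) = (of_nat a :: 'a::semiring_1)"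
  by (simp add: mat_trace_def)

lemma mat_of_rows_list_2_carrier:
  "mat_of_rows_list 2 [[a, b], [c, d]] \<in> carrier_mat 2 2"
  by (rule carrier_matI) (simp_all add: mat_of_rows_list_def)

lemma mat_of_rows_list_2_index:
  assumes "i < 2" "j < 2"
  shows "mat_of_rows_list 2 [[a, b], [c, d]] $$ (i, j) =
    (if i = 0 then if j = 0 then a else b else if j = 0 then c else d)"
  using assms by (auto simp: mat_of_rows_list_def less_2_cases_iff)

lemma sum_lessThan_2: "(\<Sum>i<2. f i) = f 0 + f (1::nat)"
  by (simp add: numeral_2_eq_2)

lemma mat_trace_2: "mat_trace (mat_of_rows_list 2 [[a, b], [c, d]]) = a + d"
  using mat_of_rows_list_2_carrier[of a b c d]
  by (simp add: mat_trace_def sum_lessThan_2 mat_of_rows_list_2_index)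

lemma SO2_minus_carrier: "i \<in> SO2_minus \<kappa> \<Longrightarrow> i \<in> carrier_mat 2 2"
  by (auto simp: SO2_minus_def mat_of_rows_list_2_carrier)

lemma one_in_SO2_minus: "1\<^sub>m 2 \<in> SO2_minus \<kappa>"
proof -
  have "1\<^sub>m 2 = mat_of_rows_list 2 [[1, \<kappa> * 0], [0, 1 + 0]]"
    by (rule eq_matI)
      (auto simp: mat_of_rows_list_2_index carrier_matD[OF mat_of_rows_list_2_carrier])
  then show ?thesis unfolding SO2_minus_def by fastforce
qed

lemma eta_mat_carrier: "eta_mat \<in> carrier_mat 2 2"
  unfolding eta_mat_def by (rule mat_of_rows_list_2_carrier)

section \<open>Unipotent and Levi elements of \<open>Q\<close>\<close>

lemma Q_unip_carrier:
  assumes "i \<in> carrier_mat 2 2" "B \<in> carrier_mat m m" "h \<in> carrier_mat 2 m"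
  shows "Q_unip (Suc m) i B h \<in> carrier_mat (2 * Suc m) (2 * Suc m)"
  using assms by (auto simp: Q_unip_def append_rows_def)

text \<open>The blocks containing \<open>h\<close> are left out: the diagonal of a product with
  \<open>sigma_mat\<close> and the extra entry picked up by \<open>rho_mat\<close> avoid
  them.\<close>

lemma Q_unip_index:
  assumes "i \<in> carrier_mat 2 2" "B \<in> carrier_mat m m" "h \<in> carrier_mat 2 m"
  shows "a < m \<Longrightarrow> b < m \<Longrightarrow> Q_unip (Suc m) i B h $$ (a, b) = of_bool (a = b)"
    and "a < m \<Longrightarrow> b < m \<Longrightarrow> Q_unip (Suc m) i B h $$ (a, m + b) = B $$ (a, b)"
    and "a < m \<Longrightarrow> b < m \<Longrightarrow> Q_unip (Suc m) i B h $$ (m + a, b) = 0"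
    and "a < m \<Longrightarrow> b < m \<Longrightarrow> Q_unip (Suc m) i B h $$ (m + a, m + b) = of_bool (a = b)"
    and "a < 2 \<Longrightarrow> b < 2 \<Longrightarrow> Q_unip (Suc m) i B h $$ (m + m + a, m + m + b) = of_bool (a = b)"
  using assms by (simp_all add: Q_unip_def append_rows_def del: add_2_eq_Suc add_2_eq_Suc')

lemma Q_unip_zero:
  assumes "i \<in> carrier_mat 2 2"
  shows "Q_unip (Suc m) i (0\<^sub>m m m) (0\<^sub>m 2 m) = 1\<^sub>m (2 * Suc m)"
proof -
  have "transpose_mat (0\<^sub>m 2 m) * transpose_mat i * eta_mat * i = 0\<^sub>m m 2"
    using assms by (simp add: left_mult_zero_mat[OF eta_mat_carrier])
  moreover have "m + m + 2 = 2 * Suc m" by simp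
  ultimately show ?thesis
    unfolding Q_unip_def diff_Suc_1 append_rows_def
    by (simp only: zero_transpose_mat index_zero_mat four_block_zero_mat four_block_one_mat
        add_0_right)
qed

lemma Q_levi_eq_four_block_mat:
  assumes "A \<in> carrier_mat m m" "A' \<in> carrier_mat m m" "i \<in> carrier_mat 2 2"
  shows "Q_levi A A' i = four_block_mat A (0\<^sub>m m (m + 2)) (0\<^sub>m (m + 2) m)
    (four_block_mat (transpose_mat A') (0\<^sub>m m 2) (0\<^sub>m 2 m) i)"
  unfolding Q_levi_def diag_block_mat.simps(2)[of A] diag_block_mat.simps(2)[of "transpose_mat A'"]
    diag_block_mat_singleton Let_def
  using assms by simp

lemma Q_levi_carrier:
  assumes "A \<in> carrier_mat m m" "A' \<in> carrier_mat m m" "i \<in> carrier_mat 2 2"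
  shows "Q_levi A A' i \<in> carrier_mat (2 * Suc m) (2 * Suc m)"
  using assms by (intro carrier_matI) (simp_all add: Q_levi_eq_four_block_mat)

lemma Q_levi_one: "Q_levi (1\<^sub>m m) (1\<^sub>m m) (1\<^sub>m 2) = 1\<^sub>m (2 * Suc m)"
proof -
  have "m + (m + 2) = 2 * Suc m" by simp
  then show ?thesis
    unfolding Q_levi_eq_four_block_mat[OF one_carrier_mat one_carrier_mat one_carrier_mat]
    by (simp only: transpose_one four_block_one_mat)
qed

lemma mat_trace_Q_levi:
  assumes "A \<in> carrier_mat m m" "A' \<in> carrier_mat m m" "i \<in> carrier_mat 2 2"
  shows "mat_trace (Q_levi A A' i) = mat_trace A + mat_trace A' + mat_trace i"
proof -
  have A': "transpose_mat A' \<in> carrier_mat m m" using assms by simp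
  have "four_block_mat (transpose_mat A') (0\<^sub>m m 2) (0\<^sub>m 2 m) i \<in> carrier_mat (m + 2) (m + 2)"
    using assms by (intro four_block_carrier_mat) auto
  then show ?thesis
    using assms
    by (simp add: Q_levi_eq_four_block_mat mat_trace_four_block mat_trace_four_block[OF A']
        mat_trace_transpose ac_simps)
qed

lemma alternating_mat_zero: "alternating_mat (0\<^sub>m m m)"
  by (auto simp: alternating_mat_def)

lemma delta_mat_carrier: "delta_mat \<kappa> \<in> carrier_mat 2 2"
  unfolding delta_mat_def by (rule mat_of_rows_list_2_carrier)

lemma Q_levi_in_Q_minus:
  assumes A: "A \<in> carrier_mat m m" "A' \<in> carrier_mat m m" "inverts_mat A A'" "inverts_mat A' A"
    and i: "i \<in> SO2_minus \<kappa>"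
  shows "Q_levi A A' i \<in> Q_minus \<kappa> (Suc m)"
proof -
  have ic: "i \<in> carrier_mat 2 2" using i by (rule SO2_minus_carrier)
  have "Q_levi A A' i = Q_levi A A' i * Q_unip (Suc m) i (0\<^sub>m m m) (0\<^sub>m 2 m)"
    using Q_levi_carrier[OF A(1,2) ic] by (simp only: Q_unip_zero[OF ic] right_mult_one_mat)
  moreover have "transpose_mat (0\<^sub>m m m) + transpose_mat (0\<^sub>m 2 m) * delta_mat \<kappa> * 0\<^sub>m 2 m = 0\<^sub>m m m"
    using delta_mat_carrier[of \<kappa>] by simp
  then have "alternating_mat
      (transpose_mat (0\<^sub>m m m) + transpose_mat (0\<^sub>m 2 m) * delta_mat \<kappa> * 0\<^sub>m 2 m)"
    by (simp only: alternating_mat_zero)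
  ultimately show ?thesis
    unfolding Q_minus_def mem_Collect_eq diff_Suc_1 using A i zero_carrier_mat by blast
qed

lemma inverts_mat_one: "inverts_mat (1\<^sub>m m) (1\<^sub>m m :: 'a::semiring_1 mat)"
  by (simp add: inverts_mat_def)

lemma one_in_Q_minus: "1\<^sub>m (2 * Suc m) \<in> Q_minus \<kappa> (Suc m)"
  unfolding Q_levi_one[symmetric]
  by (rule Q_levi_in_Q_minus) (auto simp: inverts_mat_one one_in_SO2_minus)

section \<open>Multiplication by \<open>sigma_mat\<close> and \<open>rho_mat\<close>\<close>

lemma mult_sigma_in_Q_double_coset:
  assumes "x \<in> Q_minus \<kappa> (Suc m)"
  shows "x * sigma_mat (Suc m) s \<in> Q_double_coset \<kappa> (Suc m) s"
proof -
  have "x * sigma_mat (Suc m) s * 1\<^sub>m (2 * Suc m) = x * sigma_mat (Suc m) s"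
    by (rule right_mult_one_mat') (simp add: sigma_mat_def)
  then show ?thesis
    unfolding Q_double_coset_def using assms one_in_Q_minus[of m \<kappa>]
    by (metis (mono_tags, lifting) CollectI)
qed

lemma sigma_perm_less: "s \<le> m \<Longrightarrow> j < 2 * Suc m \<Longrightarrow> sigma_perm (Suc m) s j < 2 * Suc m"
  by (auto simp: sigma_perm_def)

lemma index_mult_sigma:
  assumes "x \<in> carrier_mat (2 * Suc m) (2 * Suc m)" "s \<le> m" "a < 2 * Suc m" "b < 2 * Suc m"
  shows "(x * sigma_mat (Suc m) s) $$ (a, b) = x $$ (a, sigma_perm (Suc m) s b)"
proof -
  have "(x * sigma_mat (Suc m) s) $$ (a, b) =
      (\<Sum>k<2 * Suc m. x $$ (a, k) * (if k = sigma_perm (Suc m) s b then 1 else 0))"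
    using assms
    by (simp add: sigma_mat_def scalar_prod_def lessThan_atLeast0 del: mult_Suc_right
        sum.op_ivl_Suc)
  also have "\<dots> = (\<Sum>k<2 * Suc m. if k = sigma_perm (Suc m) s b then x $$ (a, k) else 0)"
    by (intro sum.cong) auto
  also have "\<dots> = x $$ (a, sigma_perm (Suc m) s b)"
    using sigma_perm_less[OF assms(2,4)] by (simp only: sum.delta finite_lessThan lessThan_iff if_True)
  finally show ?thesis .
qed

lemma mult_sigma_carrier:
  "x \<in> carrier_mat (2 * Suc m) (2 * Suc m) \<Longrightarrow>
    x * sigma_mat (Suc m) s \<in> carrier_mat (2 * Suc m) (2 * Suc m)"
  by (intro carrier_matI) (simp_all add: sigma_mat_def)

lemma mult_sigma_0:
  assumes "x \<in> carrier_mat (2 * Suc m) (2 * Suc m)"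
  shows "x * sigma_mat (Suc m) 0 = x"
  using assms mult_sigma_carrier[OF assms, of 0]
  by (intro eq_matI) (auto simp: index_mult_sigma sigma_perm_def simp del: mult_Suc_right)

lemma rho_index:
  assumes "a < 2 * Suc m" "b < 2 * Suc m"
  shows "rho_mat (Suc m) $$ (a, b) =
    (of_bool (a = b) + of_bool (a = 2 * m \<and> b = 2 * m + 1) :: 'a::field)"
  using assms by (auto simp: rho_mat_def Let_def mat_of_rows_list_def nth_Cons' )

lemma rho_carrier: "rho_mat (Suc m) \<in> carrier_mat (2 * Suc m) (2 * Suc m)"
  by (auto simp: rho_mat_def Let_def mat_of_rows_list_def)

text \<open>\<open>rho_mat\<close> is the identity plus a matrix unit at
  \<open>(2 * m, 2 * m + 1)\<close>, and the trace of a matrix unit times \<open>y\<close> is the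
  transposed entry of \<open>y\<close>.\<close>

lemma mat_trace_rho_mult:
  fixes y :: "'a::field mat"
  assumes y: "y \<in> carrier_mat (2 * Suc m) (2 * Suc m)"
  shows "mat_trace (rho_mat (Suc m) * y) = mat_trace y + y $$ (2 * m + 1, 2 * m)"
proof -
  let ?N = "2 * Suc m"
  have "(rho_mat (Suc m) * y) $$ (a, a) =
      y $$ (a, a) + (if a = 2 * m then y $$ (2 * m + 1, 2 * m) else 0)" if a: "a < ?N" for a
  proof -
    have "(rho_mat (Suc m) * y) $$ (a, a) = (\<Sum>k<?N. rho_mat (Suc m) $$ (a, k) * y $$ (k, a))"
      using a y rho_carrier[of m, where 'a = 'a]
      by (auto simp: scalar_prod_def lessThan_atLeast0 simp del: mult_Suc_right intro!: sum.cong)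
    also have "\<dots> = (\<Sum>k<?N. (if k = a then y $$ (k, a) else 0) +
        (if k = 2 * m + 1 then if a = 2 * m then y $$ (k, a) else 0 else 0))"
      using a by (intro sum.cong refl) (auto simp: rho_index simp del: mult_Suc_right)
    also have "\<dots> = y $$ (a, a) + (if a = 2 * m then y $$ (2 * m + 1, 2 * m) else 0)"
      using a by (simp add: sum.distrib del: sum.lessThan_Suc)
    finally show ?thesis .
  qed
  then have "mat_trace (rho_mat (Suc m) * y) =
      (\<Sum>a<?N. y $$ (a, a) + (if a = 2 * m then y $$ (2 * m + 1, 2 * m) else 0))"
    using rho_carrier[of m, where 'a = 'a]
    by (auto simp: mat_trace_def simp del: mult_Suc_right intro!: sum.cong)
  also have "\<dots> = mat_trace y + y $$ (2 * m + 1, 2 * m)"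
    using y by (simp add: mat_trace_def sum.distrib del: sum.lessThan_Suc)
  finally show ?thesis .
qed

section \<open>Field elements realised as traces\<close>

lemma ex_Q_minus_trace_square:
  fixes t \<kappa> :: "'a::field"
  assumes c: "CHAR('a) = 2" and s: "0 < s" "s \<le> m"
  shows "\<exists>x \<in> Q_minus \<kappa> (Suc m). mat_trace (x * sigma_mat (Suc m) s) = t\<^sup>2 \<and>
    mat_trace (rho_mat (Suc m) * (x * sigma_mat (Suc m) s)) = t\<^sup>2"
proof -
  define h where "h = mat 2 m (\<lambda>(a, j). if a = 0 \<and> j = 0 then t else 0)"
  define B where "B = mat m m (\<lambda>(a, j). if a = 0 \<and> j = 0 then t\<^sup>2 else 0)"
  define x where "x = Q_unip (Suc m) (1\<^sub>m 2) B h"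
  have carr: "B \<in> carrier_mat m m" "h \<in> carrier_mat 2 m" by (auto simp: B_def h_def)
  have xc: "x \<in> carrier_mat (2 * Suc m) (2 * Suc m)"
    unfolding x_def using carr by (intro Q_unip_carrier) auto
  \<comment> \<open>The top left entry of \<open>delta_mat\<close> is 1, so the quadratic term has
    the single entry \<open>t\<^sup>2\<close>, which \<open>B\<close> cancels in characteristic
    two.\<close>
  have "transpose_mat B + transpose_mat h * delta_mat \<kappa> * h = 0\<^sub>m m m"
  proof (rule eq_matI)
    fix a b assume "a < dim_row (0\<^sub>m m m)" "b < dim_col (0\<^sub>m m m)"
    then show "(transpose_mat B + transpose_mat h * delta_mat \<kappa> * h) $$ (a, b) = 0\<^sub>m m m $$ (a, b)"
      using add_self_CHAR_2[OF c, of "t * t"]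
      by (auto simp: B_def h_def delta_mat_def mat_of_rows_list_def scalar_prod_def
          numeral_2_eq_2 power2_eq_square)
  qed (use carr in auto)
  then have "alternating_mat (transpose_mat B + transpose_mat h * delta_mat \<kappa> * h)"
    by (simp only: alternating_mat_zero)
  moreover have "x = Q_levi (1\<^sub>m m) (1\<^sub>m m) (1\<^sub>m 2) * Q_unip (Suc m) (1\<^sub>m 2) B h"
    using xc by (simp only: Q_levi_one x_def[symmetric] left_mult_one_mat)
  ultimately have xQ: "x \<in> Q_minus \<kappa> (Suc m)"
    unfolding Q_minus_def mem_Collect_eq diff_Suc_1
    using carr one_in_SO2_minus[of \<kappa>] inverts_mat_one one_carrier_mat by blast
  have last: "x $$ (m + m + a, m + m + b) = of_bool (a = b)" if "a < 2" "b < 2" for a b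
    unfolding x_def using carr that by (intro Q_unip_index(5)) auto
  have tr: "mat_trace (x * sigma_mat (Suc m) s) = t\<^sup>2"
  proof -
    let ?f = "\<lambda>a. x $$ (a, sigma_perm (Suc m) s a)"
    have "mat_trace (x * sigma_mat (Suc m) s) = (\<Sum>a<m + m + 2. ?f a)"
      unfolding mat_trace_def using xc s
      by (intro sum.cong) (auto simp: index_mult_sigma simp del: index_mult_mat(1))
    \<comment> \<open>Rows \<open>a\<close> and \<open>m + a\<close> are paired: for
      \<open>a < s\<close> the permutation brings the diagonal entry of \<open>B\<close> and a zero
      onto the diagonal, otherwise two ones cancel, as they do in the last block.\<close>
    also have "\<dots> = (\<Sum>a<m. ?f a + ?f (m + a)) + (?f (m + m) + ?f (m + m + 1))"
      by (simp only: sum_lessThan_add sum.distrib sum_lessThan_2 add_0_right)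
    also have "?f (m + m) + ?f (m + m + 1) = 0"
      using s last[of 0 0] last[of 1 1] add_self_CHAR_2[OF c, of 1] by (simp add: sigma_perm_def)
    also have "(\<Sum>a<m. ?f a + ?f (m + a)) = (\<Sum>a<m. if a = 0 then t\<^sup>2 else 0)"
    proof (intro sum.cong refl)
      fix a assume "a \<in> {..<m}"
      then have a: "a < m" by simp
      note idx = Q_unip_index(1-4)[OF one_carrier_mat carr a a, folded x_def]
      show "?f a + ?f (m + a) = (if a = 0 then t\<^sup>2 else 0)"
      proof (cases "a < s")
        case True
        then have "?f a = B $$ (a, a)" "?f (m + a) = 0"
          using a s idx(2,3) by (simp_all add: sigma_perm_def)
        then show ?thesis using a by (simp add: B_def)
      next
        case False
        then have "?f a = 1" "?f (m + a) = 1"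
          using a idx(1,4) by (simp_all add: sigma_perm_def)
        then show ?thesis using False s add_self_CHAR_2[OF c, of 1] by simp
      qed
    qed
    finally show ?thesis using s by simp
  qed
  have "mat_trace (rho_mat (Suc m) * (x * sigma_mat (Suc m) s)) = t\<^sup>2"
  proof -
    have "(x * sigma_mat (Suc m) s) $$ (2 * m + 1, 2 * m) = x $$ (m + m + 1, m + m + 0)"
      using index_mult_sigma[OF xc s(2), of "2 * m + 1" "2 * m"] s
      by (simp add: sigma_perm_def mult_2)
    also have "\<dots> = 0" by (subst last) auto
    finally show ?thesis
      unfolding mat_trace_rho_mult[OF mult_sigma_carrier[OF xc]] tr by simp
  qed
  with xQ tr show ?thesis by blast
qed

text \<open>For \<open>s = 0\<close> the permutation is the identity, so Levi elements lie in the
  double coset themselves. With \<open>rho_mat\<close> the factor \<open>i\<close> is taken to be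
  the identity, whose trace is \<open>1 + 1 = 0\<close>.\<close>

lemma Q_levi_traces:
  fixes \<kappa> :: "'a::field"
  assumes A: "A \<in> carrier_mat m m" "A' \<in> carrier_mat m m" "inverts_mat A A'" "inverts_mat A' A"
  shows "i \<in> SO2_minus \<kappa> \<Longrightarrow>
      mat_trace A + mat_trace A' + mat_trace i \<in> mat_trace ` Q_double_coset \<kappa> (Suc m) 0"
    and "CHAR('a) = 2 \<Longrightarrow>
      mat_trace A + mat_trace A' \<in> mat_trace ` (*) (rho_mat (Suc m)) ` Q_double_coset \<kappa> (Suc m) 0"
proof -
  have D: "Q_levi A A' i \<in> Q_double_coset \<kappa> (Suc m) 0" if i: "i \<in> SO2_minus \<kappa>" for i
    using mult_sigma_in_Q_double_coset[OF Q_levi_in_Q_minus[OF A i], of 0]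
      mult_sigma_0[OF Q_levi_carrier[OF A(1,2) SO2_minus_carrier[OF i]]]
    by simp
  show "mat_trace A + mat_trace A' + mat_trace i \<in> mat_trace ` Q_double_coset \<kappa> (Suc m) 0"
    if i: "i \<in> SO2_minus \<kappa>"
    using imageI[OF D[OF i], of mat_trace]
    unfolding mat_trace_Q_levi[OF A(1,2) SO2_minus_carrier[OF i]] .
  assume c: "CHAR('a) = 2"
  let ?x = "Q_levi A A' (1\<^sub>m 2)"
  have "?x $$ (2 * m + 1, 2 * m) = 0"
    using A by (auto simp: Q_levi_def Let_def)
  then have "mat_trace (rho_mat (Suc m) * ?x) = mat_trace A + mat_trace A' + (1 + 1)"
    using A Q_levi_carrier[OF A(1,2), of "1\<^sub>m 2"]
    by (simp add: mat_trace_rho_mult mat_trace_Q_levi[OF A(1,2)] mat_trace_one)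
  then have "mat_trace (rho_mat (Suc m) * ?x) = mat_trace A + mat_trace A'"
    by (simp only: add_self_CHAR_2[OF c] add_0_right)
  then show "mat_trace A + mat_trace A' \<in>
      mat_trace ` (*) (rho_mat (Suc m)) ` Q_double_coset \<kappa> (Suc m) 0"
    using D[OF one_in_SO2_minus] by (metis image_eqI)
qed

lemma double_coset_traces_s_pos:
  fixes \<kappa> :: "'a::{field,finite}"
  assumes c: "CHAR('a) = 2" and s: "0 < s" "s \<le> m"
  shows "mat_trace ` Q_double_coset \<kappa> (Suc m) s = UNIV"
    and "mat_trace ` (*) (rho_mat (Suc m)) ` Q_double_coset \<kappa> (Suc m) s = UNIV"
proof -
  have "y \<in> mat_trace ` Q_double_coset \<kappa> (Suc m) s \<and>
    y \<in> mat_trace ` (*) (rho_mat (Suc m)) ` Q_double_coset \<kappa> (Suc m) s" for y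
  proof -
    obtain t where "y = t\<^sup>2" using surj_power2_CHAR_2[OF c] by (metis surjD)
    then show ?thesis
      using ex_Q_minus_trace_square[OF c s, of \<kappa> t] mult_sigma_in_Q_double_coset
      by (metis image_eqI)
  qed
  then show "mat_trace ` Q_double_coset \<kappa> (Suc m) s = UNIV"
    and "mat_trace ` (*) (rho_mat (Suc m)) ` Q_double_coset \<kappa> (Suc m) s = UNIV"
    by blast+
qed

text \<open>With \<open>A = 1\<close> the two blocks of size \<open>m\<close> cancel, and the last
  block has trace \<open>d1 + (d1 + d2) = d2\<close>.\<close>

lemma SO2_traces_in_double_coset_0:
  fixes \<kappa> :: "'a::field"
  assumes c: "CHAR('a) = 2"
  shows "{d2. \<exists>d1. d1\<^sup>2 + d1 * d2 + \<kappa> * d2\<^sup>2 = 1} \<subseteq> mat_trace ` Q_double_coset \<kappa> (Suc m) 0"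
proof clarify
  fix d1 d2 assume d: "d1\<^sup>2 + d1 * d2 + \<kappa> * d2\<^sup>2 = 1"
  let ?i = "mat_of_rows_list 2 [[d1, \<kappa> * d2], [d2, d1 + d2]]"
  have "?i \<in> SO2_minus \<kappa>" unfolding SO2_minus_def using d by blast
  from Q_levi_traces(1)[OF one_carrier_mat one_carrier_mat inverts_mat_one inverts_mat_one this, of m]
  show "d2 \<in> mat_trace ` Q_double_coset \<kappa> (Suc m) 0"
    by (simp add: mat_trace_2 add_self_CHAR_2[OF c] flip: add.assoc)
qed

lemma add_inverse_in_rho_double_coset:
  fixes \<kappa> a :: "'a::field"
  assumes c: "CHAR('a) = 2" and a: "a \<noteq> 0"
  shows "a + inverse a \<in> mat_trace ` (*) (rho_mat 2) ` Q_double_coset \<kappa> 2 0"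
proof -
  have "inverts_mat (mat 1 1 (\<lambda>_. a)) (mat 1 1 (\<lambda>_. inverse a))"
    "inverts_mat (mat 1 1 (\<lambda>_. inverse a)) (mat 1 1 (\<lambda>_. a))"
    unfolding inverts_mat_def using a by (auto intro!: eq_matI simp: scalar_prod_def)
  from Q_levi_traces(2)[OF _ _ this c, of 1 \<kappa>] show ?thesis
    by (simp add: mat_trace_def numeral_2_eq_2)
qed

lemma rho_double_coset_3_traces:
  fixes \<kappa> :: "'a::{field,finite}"
  assumes c: "CHAR('a) = 2" and q: "CARD('a) \<ge> 4"
  shows "mat_trace ` (*) (rho_mat 3) ` Q_double_coset \<kappa> 3 0 = UNIV"
proof -
  have "\<not> UNIV \<subseteq> {0, 1 :: 'a}"
    using card_mono[of "{0, 1 :: 'a}" UNIV] q by auto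
  then obtain d :: 'a where d: "d \<noteq> 0" "d \<noteq> 1" by blast
  have d1: "1 + inverse d \<noteq> 0"
    using d add_eq_0_iff_CHAR_2[OF c, of 1 "inverse d"] by auto
  have "y \<in> mat_trace ` (*) (rho_mat 3) ` Q_double_coset \<kappa> 3 0" for y
  proof -
    \<comment> \<open>\<open>?A\<close> has trace \<open>t\<close> and its inverse has trace
      \<open>t / d\<close>, so \<open>t\<close> is chosen to make the sum
      \<open>t * (1 + 1/d)\<close> equal to \<open>y\<close>; this needs \<open>d\<close> different
      from 1.\<close>
    define t where "t = y / (1 + inverse d)"
    let ?A = "mat_of_rows_list 2 [[t, d], [1, 0]]"
    let ?A' = "mat_of_rows_list 2 [[0, 1], [inverse d, t * inverse d]]"
    have "d * (t * inverse d) = t" using d by (simp add: field_simps)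
    then have "t + d * (t * inverse d) = 0" by (simp only: add_self_CHAR_2[OF c])
    then have "inverts_mat ?A ?A'" "inverts_mat ?A' ?A"
      unfolding inverts_mat_def using d add_self_CHAR_2[OF c, of 1]
      by (auto intro!: eq_matI simp: mat_of_rows_list_def scalar_prod_def numeral_2_eq_2
          less_Suc_eq)
    from Q_levi_traces(2)[OF mat_of_rows_list_2_carrier mat_of_rows_list_2_carrier this c, of \<kappa>]
    have "t + t * inverse d \<in> mat_trace ` (*) (rho_mat 3) ` Q_double_coset \<kappa> 3 0"
      unfolding mat_trace_2 by simp
    moreover have "t + t * inverse d = t * (1 + inverse d)" by (simp add: distrib_left)
    ultimately show ?thesis using d1 by (simp add: t_def)
  qed
  then show ?thesis by blast
qed

section \<open>Irreducibility of the quadratic and assembly of the cases\<close>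

lemma irreducible_quadratic_no_root:
  fixes \<kappa> z :: "'a::field"
  assumes "irreducible [:\<kappa>, 1, 1:]"
  shows "z\<^sup>2 + z + \<kappa> \<noteq> 0"
proof
  assume "z\<^sup>2 + z + \<kappa> = 0"
  then have "poly [:\<kappa>, 1, 1:] z = 0" by (simp add: power2_eq_square algebra_simps)
  then obtain p where p: "[:\<kappa>, 1, 1:] = [:- z, 1:] * p"
    unfolding poly_eq_0_iff_dvd dvd_def by blast
  have p0: "p \<noteq> 0" using p by auto
  have "degree ([:- z, 1:] * p) = 2" unfolding p[symmetric] by simp
  then have "degree p = 1" using p0 by (subst (asm) degree_mult_eq) auto
  moreover have "is_unit [:- z, 1:] \<or> is_unit p" using assms p by (rule irreducibleD)
  ultimately show False using p0 by (auto simp: is_unit_iff_degree)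
qed

theorem theorem15:
  fixes \<kappa> :: "'a::{field,finite}" and r n i :: nat and gs :: "'a mat list"
  assumes "CARD('a) = 2 ^ r"
    and "irreducible [:\<kappa>, 1, 1:]"
    and "distinct gs" and "set gs = DC \<kappa> i n"
    and "(i \<in> {1, 2} \<and> even n \<and> n \<ge> 2) \<or>
      (i = 3 \<and> even n \<and> (n \<ge> 4 \<or> (n = 2 \<and> CARD('a) \<ge> 8))) \<or>
      (i = 4 \<and> even n \<and> n \<ge> 4) \<or>
      (i = 1 \<and> odd n \<and> n \<ge> 1) \<or>
      (i \<in> {2, 3} \<and> odd n \<and> n \<ge> 3) \<or>
      (i = 4 \<and> odd n \<and> (n \<ge> 5 \<or> (n = 3 \<and> CARD('a) \<ge> 4)))"
  shows "F2_linear_iso (trace_word r gs) (dual_code (length gs) (trace_code gs))"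
proof (rule trace_word_iso[OF assms(1)])
  fix H :: "'a set"
  assume H: "0 \<in> H" "\<And>x y. x \<in> H \<Longrightarrow> y \<in> H \<Longrightarrow> x + y \<in> H" "mat_trace ` set gs \<subseteq> H"
  have c: "CHAR('a) = 2" using assms(1) by (rule CHAR_eq_2)
  define m where "m = n - 1"
  have n: "n = Suc m" using assms(5) by (auto simp: m_def)
  have half: "H = UNIV" if "mat_trace ` Q_double_coset \<kappa> (Suc k) 0 \<subseteq> H" for k
    using add_closed_eq_UNIV_if_gt_half[OF H(2) _
        norm_form_second_coordinates[OF c irreducible_quadratic_no_root[OF assms(2)]]]
      SO2_traces_in_double_coset_0[OF c, of \<kappa> k] that by blast
  \<comment> \<open>For each \<open>i\<close> the first alternative is \<open>s = 0\<close> and the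
    second is \<open>s > 0\<close>, where \<open>s\<close> is \<open>m\<close>,
    \<open>m - 1\<close>, \<open>m - 1\<close>, \<open>m - 2\<close> for
    \<open>i = 1, 2, 3, 4\<close>; none of these subtractions is truncated.\<close>
  consider "i = 1" "m = 0" | "i = 1" "m > 0" | "i = 2" "m = 1" | "i = 2" "m > 1"
    | "i = 3" "m = 1" "CARD('a) \<ge> 8" | "i = 3" "m > 1"
    | "i = 4" "m = 2" "CARD('a) \<ge> 4" | "i = 4" "m > 2"
    using assms(5) unfolding n by (auto; force)
  then show "H = UNIV"
  proof cases
    case 1
    then show ?thesis using half[of 0] H(3) assms(4) by (simp add: DC_def n)
  next
    case 2
    then show ?thesis
      using double_coset_traces_s_pos(1)[OF c, of m m \<kappa>] H(3) assms(4) by (auto simp: DC_def n)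
  next
    case 3
    then show ?thesis using half[of 1] H(3) assms(4) by (simp add: DC_def n numeral_2_eq_2)
  next
    case 4
    then show ?thesis
      using double_coset_traces_s_pos(1)[OF c, of "m - 1" m \<kappa>] H(3) assms(4)
      by (auto simp: DC_def n)
  next
    case 5
    then have "mat_trace ` (*) (rho_mat 2) ` Q_double_coset \<kappa> 2 0 \<subseteq> H"
      using H(3) assms(4) by (simp add: DC_def n numeral_2_eq_2)
    then show ?thesis
      using add_closed_eq_UNIV_if_add_inverse[OF c 5(3) H(1,2)]
        add_inverse_in_rho_double_coset[OF c, of _ \<kappa>] by blast
  next
    case 6
    then show ?thesis
      using double_coset_traces_s_pos(2)[OF c, of "m - 1" m \<kappa>] H(3) assms(4)
      by (auto simp: DC_def n)
  next
    case 7
    then have "mat_trace ` (*) (rho_mat 3) ` Q_double_coset \<kappa> 3 0 \<subseteq> H"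
      using H(3) assms(4) by (simp add: DC_def n numeral_3_eq_3 numeral_2_eq_2)
    then show ?thesis using rho_double_coset_3_traces[OF c 7(3), of \<kappa>] by blast
  next
    case 8
    then show ?thesis
      using double_coset_traces_s_pos(2)[OF c, of "m - 2" m \<kappa>] H(3) assms(4)
      by (auto simp: DC_def n numeral_3_eq_3 numeral_2_eq_2)
  qed
qed

end
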